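(* Let $n,m\ge 1$ be integers, let $x^1,\ldots,x^m\in\mathbb{R}^n$ be given points and let $\omega_1,\ldots,\omega_m>0$ be given weights. Then the three relaxations $({\rm CR_{box}})$, $({\rm SDP_{box}})$, $({\rm SOCP_{box}})$ of the box-constrained weighted maximin dispersion problem $\max_{x\in[-1,1]^n}\min_{i=1,\ldots,m}\omega_i\|x-x^i\|^2$ (defined in the context) satisfy $$v({\rm CR_{box}})=v({\rm SDP_{box}})=v({\rm SOCP_{box}}).$$
   Context: $\|\cdot\|$ is the Euclidean norm, $S^{n+1}$ is the set of real symmetric $(n+1)\times(n+1)$ matrices, $Z\succeq 0$ means that $Z$ is positive semidefinite, ${\rm Tr}$ is the trace, and for $i=1,\ldots,m$ $$A^i=\begin{pmatrix} I & -x^i\\ -(x^i)^T & \|x^i\|^2\end{pmatrix}\in S^{n+1},$$ with $I$ the $n\times n$ identity matrix. $v({\rm CR_{box}})$ is the optimal value of the linear program $$\max_{x\in\mathbb{R}^n,\ \zeta\in\mathbb{R}}\ \zeta\quad\text{s.t.}\quad \omega_i\left(n-2(x^i)^Tx+\|x^i\|^2\right)\ge\zeta,\ i=1,\ldots,m,\quad x\in[-1,1]^n.$$ $v({\rm SDP_{box}})$ is defined by $$\frac{1}{v({\rm SDP_{box}})}=\min_{Z\in S^{n+1}} Z_{n+1,n+1}\quad\text{s.t.}\quad \omega_i{\rm Tr}(A^iZ)\ge 1\ (i=1,\ldots,m),\quad Z_{jj}\le Z_{n+1,n+1}\ (j=1,\ldots,n),\quad Z\succeq 0.$$ $v({\rm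 SOCP_{box}})$ is defined by $$\frac{1}{v({\rm SOCP_{box}})}=\min_{Z\in S^{n+1}} Z_{n+1,n+1}\quad\text{s.t.}\quad \omega_i{\rm Tr}(A^iZ)\ge 1\ (i=1,\ldots,m),\quad Z_{jj}\le Z_{n+1,n+1}\ (j=1,\ldots,n),$$ $$\left\|\begin{pmatrix}2Z_{j,n+1}\\ Z_{jj}-Z_{n+1,n+1}\end{pmatrix}\right\|\le Z_{jj}+Z_{n+1,n+1}\ (j=1,\ldots,n).$$ *)

theory Defs
  imports "HOL-Analysis.Analysis"
begin

text \<open>The dimension is n = CARD('n). The n + 1 row and column indices are the elements of
  \<open>'n option\<close>: \<open>Some j\<close> is the index j, and \<open>None\<close> is the last index n + 1.\<close>

definition symmetric_matrix :: "real ^ 'k ^ 'k \<Rightarrow> bool" where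
  "symmetric_matrix Z \<longleftrightarrow> transpose Z = Z"

definition psd_matrix :: "real ^ 'k ^ 'k \<Rightarrow> bool" where
  "psd_matrix Z \<longleftrightarrow> symmetric_matrix Z \<and> (\<forall>z. 0 \<le> z \<bullet> (Z *v z))"

definition A_matrix :: "real ^ 'n \<Rightarrow> real ^ ('n option) ^ ('n option)" where
  "A_matrix p = (\<chi> r c.
     (case r of
        Some j \<Rightarrow> (case c of Some k \<Rightarrow> (mat 1 :: real ^ 'n ^ 'n) $ j $ k | None \<Rightarrow> - (p $ j))
      | None \<Rightarrow> (case c of Some k \<Rightarrow> - (p $ k) | None \<Rightarrow> (norm p)\<^sup>2)))"

text \<open>The points and weights are families over \<open>nat\<close>; only the indices 1, ..., m are used.\<close>

definition CR_box_feasible ::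
  "nat \<Rightarrow> (nat \<Rightarrow> real) \<Rightarrow> (nat \<Rightarrow> real ^ 'n) \<Rightarrow> (real ^ 'n) \<times> real \<Rightarrow> bool" where
  "CR_box_feasible m \<omega> p = (\<lambda>(x, \<zeta>).
     (\<forall>i\<in>{1..m}. \<omega> i * (real CARD('n) - 2 * (p i \<bullet> x) + (norm (p i))\<^sup>2) \<ge> \<zeta>) \<and>
     (\<forall>j. x $ j \<in> {-1..1}))"

definition SDP_box_feasible ::
  "nat \<Rightarrow> (nat \<Rightarrow> real) \<Rightarrow> (nat \<Rightarrow> real ^ 'n) \<Rightarrow> real ^ ('n option) ^ ('n option) \<Rightarrow> bool" where
  "SDP_box_feasible m \<omega> p Z \<longleftrightarrow>
     symmetric_matrix Z \<and>
     (\<forall>i\<in>{1..m}. \<omega> i * trace (A_matrix (p i) ** Z) \<ge> 1) \<and>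
     (\<forall>j. Z $ Some j $ Some j \<le> Z $ None $ None) \<and>
     psd_matrix Z"

definition SOCP_box_feasible ::
  "nat \<Rightarrow> (nat \<Rightarrow> real) \<Rightarrow> (nat \<Rightarrow> real ^ 'n) \<Rightarrow> real ^ ('n option) ^ ('n option) \<Rightarrow> bool" where
  "SOCP_box_feasible m \<omega> p Z \<longleftrightarrow>
     symmetric_matrix Z \<and>
     (\<forall>i\<in>{1..m}. \<omega> i * trace (A_matrix (p i) ** Z) \<ge> 1) \<and>
     (\<forall>j. Z $ Some j $ Some j \<le> Z $ None $ None) \<and>
     (\<forall>j. norm (vector [2 * Z $ Some j $ None, Z $ Some j $ Some j - Z $ None $ None] :: real ^ 2)
          \<le> Z $ Some j $ Some j + Z $ None $ None)"

text \<open>Optimal values are taken in the extended reals, so that the supremum and infimum have their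
  usual meaning also for infeasible or unbounded programs. Since \<open>SDP_box\<close> and \<open>SOCP_box\<close>
  are minimization problems for 1 / v, their values are the reciprocals of the infima.\<close>

definition v_CR_box :: "nat \<Rightarrow> (nat \<Rightarrow> real) \<Rightarrow> (nat \<Rightarrow> real ^ 'n) \<Rightarrow> ereal" where
  "v_CR_box m \<omega> p = (SUP y\<in>{y. CR_box_feasible m \<omega> p y}. ereal (snd y))"

definition v_SDP_box :: "nat \<Rightarrow> (nat \<Rightarrow> real) \<Rightarrow> (nat \<Rightarrow> real ^ 'n) \<Rightarrow> ereal" where
  "v_SDP_box m \<omega> p = 1 / (INF Z\<in>{Z. SDP_box_feasible m \<omega> p Z}. ereal (Z $ None $ None))"

definition v_SOCP_box :: "nat \<Rightarrow> (nat \<Rightarrow> real) \<Rightarrow> (nat \<Rightarrow> real ^ 'n) \<Rightarrow> ereal" where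
  "v_SOCP_box m \<omega> p = 1 / (INF Z\<in>{Z. SOCP_box_feasible m \<omega> p Z}. ereal (Z $ None $ None))"

end

theory Submission
  imports Defs
begin

text \<open>Only the diagonal and the last column of \<open>Z\<close> enter the linear constraints. Normalising a
  feasible \<open>Z\<close> of the SOCP relaxation by its corner entry turns the last column into a point of the
  box, and since \<open>Z\<^sub>j\<^sub>j\<close> is at most the corner entry, this point together with the reciprocal of that
  entry is feasible for the linear program. Conversely, a feasible \<open>(x, \<zeta>)\<close> with \<open>\<zeta> > 0\<close> lifts to
  \<open>\<zeta>\<inverse>\<close> times the rank-one matrix of \<open>(x, 1)\<close> with its first \<open>n\<close> diagonal entries raised to 1,
  which is positive semidefinite because \<open>x\<close> lies in the box. The SDP relaxation is squeezed
  between the two.\<close>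

section \<open>The trace and cone constraints in terms of matrix entries\<close>

lemma sum_option_UNIV:
  fixes f :: "'n::finite option \<Rightarrow> 'a::comm_monoid_add"
  shows "(\<Sum>k\<in>UNIV. f k) = f None + (\<Sum>j\<in>UNIV. f (Some j))"
  by (simp add: UNIV_option_conv sum.reindex)

text \<open>Symmetry lets the last row of \<open>Z\<close> be read off its last column, whence the
  factor 2.\<close>

lemma trace_A_matrix_mult:
  fixes p :: "real ^ 'n" and Z :: "real ^ ('n option) ^ ('n option)"
  assumes "symmetric_matrix Z"
  shows "trace (A_matrix p ** Z) =
    (\<Sum>j\<in>UNIV. Z $ Some j $ Some j) - 2 * (\<Sum>j\<in>UNIV. p $ j * Z $ Some j $ None)
      + (norm p)\<^sup>2 * Z $ None $ None"
proof -
  have sym: "Z $ None $ Some j = Z $ Some j $ None" for j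
    using assms unfolding symmetric_matrix_def transpose_def by (metis vec_lambda_beta)
  have diag: "(\<Sum>k\<in>UNIV. (mat 1 :: real ^ 'n ^ 'n) $ j $ k * Z $ Some k $ Some j)
      = Z $ Some j $ Some j" for j
    by (simp add: mat_def if_distrib [of "\<lambda>x. x * _"] cong: if_cong)
  show ?thesis
    by (simp add: trace_def matrix_matrix_mult_def A_matrix_def sum_option_UNIV sym diag
        sum.distrib sum_negf)
qed

text \<open>Squaring and \<open>(a + b)^2 - (a - b)^2 = 4 * a * b\<close> give the rotated cone: the
  2x2 matrix with diagonal \<open>a\<close>, \<open>b\<close> and off-diagonal entry
  \<open>c\<close> is positive semidefinite.\<close>

lemma norm_vector_2_le_iff:
  fixes a b :: real
  shows "norm (vector [2 * c, a - b] :: real ^ 2) \<le> a + b \<longleftrightarrow> 0 \<le> a + b \<and> c\<^sup>2 \<le> a * b"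
proof -
  have "norm (vector [2 * c, a - b] :: real ^ 2) = sqrt ((2 * c)\<^sup>2 + (a - b)\<^sup>2)"
    by (simp add: norm_vec_def L2_set_def sum_2)
  moreover have "(2 * c)\<^sup>2 + (a - b)\<^sup>2 \<le> (a + b)\<^sup>2 \<longleftrightarrow> c\<^sup>2 \<le> a * b"
    by (simp add: power2_eq_square algebra_simps)
  ultimately show ?thesis
    by (auto simp: sqrt_le_D intro: real_le_lsqrt dest: order_trans [OF real_sqrt_ge_zero, rotated])
qed

section \<open>Positive semidefinite matrices and their 2x2 minors\<close>

lemma inner_matrix_vector_mult_axis:
  fixes Z :: "real ^ 'k ^ 'k"
  shows "axis i a \<bullet> (Z *v axis j b) = a * b * Z $ i $ j"
proof -
  have "(Z *v axis j b) $ i = b * Z $ i $ j"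
    by (simp add: matrix_vector_mult_def axis_def if_distrib [of "\<lambda>x. _ * x"] cong: if_cong)
  then show ?thesis by (simp add: inner_axis')
qed

lemma psd_matrix_quadratic_nonneg:
  fixes Z :: "real ^ 'k ^ 'k"
  assumes "psd_matrix Z"
  shows "0 \<le> a\<^sup>2 * Z $ i $ i + 2 * a * b * Z $ i $ j + b\<^sup>2 * Z $ j $ j"
proof -
  have sym: "Z $ j $ i = Z $ i $ j"
    using assms unfolding psd_matrix_def symmetric_matrix_def transpose_def
    by (metis vec_lambda_beta)
  have "0 \<le> (axis i a + axis j b) \<bullet> (Z *v (axis i a + axis j b))"
    using assms by (simp add: psd_matrix_def)
  then show ?thesis
    by (simp add: matrix_vector_right_distrib inner_add_left inner_add_right
        inner_matrix_vector_mult_axis sym power2_eq_square algebra_simps)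
qed

lemma psd_matrix_minor:
  fixes Z :: "real ^ 'k ^ 'k"
  assumes "psd_matrix Z"
  shows "0 \<le> Z $ i $ i" and "(Z $ i $ j)\<^sup>2 \<le> Z $ i $ i * Z $ j $ j"
proof -
  note q = psd_matrix_quadratic_nonneg [OF assms]
  have diag: "0 \<le> Z $ k $ k" for k
    using q [of 1 k 0] by simp
  then show "0 \<le> Z $ i $ i" .
  let ?a = "Z $ i $ i" and ?b = "Z $ j $ j" and ?c = "Z $ i $ j"
  show "?c\<^sup>2 \<le> ?a * ?b"
  proof (cases "?a = 0")
    case True
    \<comment> \<open>With \<open>?a = 0\<close> the form is linear in its first coordinate. The
      test vector \<open>(-(?b + 1) * ?c, ?c)\<close> gives it the value
      \<open>-(?b + 2) * ?c^2\<close>, which forces \<open>?c = 0\<close> because \<open>?b\<close>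
      is nonnegative.\<close>
    have "0 \<le> 2 * (- (?b + 1) * ?c) * ?c + ?c\<^sup>2 * ?b"
      using q [of "- (?b + 1)" i ?c j] True by (simp add: algebra_simps)
    then have "0 \<le> - ((?b + 2) * ?c\<^sup>2)"
      by (simp add: power2_eq_square algebra_simps)
    then have "(?b + 2) * ?c\<^sup>2 \<le> 0" by simp
    then have "?c\<^sup>2 \<le> 0"
      using diag [of j] by (simp add: mult_le_0_iff)
    with True show ?thesis by simp
  next
    case False
    then have pos: "?a > 0" using diag [of i] by simp
    \<comment> \<open>With second coordinate \<open>?a\<close>, the form is smallest at first
      coordinate \<open>-?c\<close>; its value there is \<open>?a\<close> times the
      determinant.\<close>
    have "0 \<le> ?a * (?a * ?b - ?c\<^sup>2)"
      using q [of "- ?c" i ?a j] by (simp add: power2_eq_square algebra_simps)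
    then show ?thesis using pos by (simp add: zero_le_mult_iff)
  qed
qed

text \<open>The cone constraints express positive semidefiniteness of just the 2x2 principal
  submatrices on the indices \<open>Some j\<close> and \<open>None\<close>.\<close>

lemma SDP_box_feasible_imp_SOCP_box_feasible:
  assumes "SDP_box_feasible m \<omega> p Z"
  shows "SOCP_box_feasible m \<omega> p Z"
  using assms
  by (auto simp: SDP_box_feasible_def SOCP_box_feasible_def norm_vector_2_le_iff
      intro: psd_matrix_minor add_nonneg_nonneg)

section \<open>From the cone relaxation to the linear program\<close>

lemma SOCP_box_feasible_imp_CR_box_feasible:
  fixes p :: "nat \<Rightarrow> real ^ 'n"
  assumes m: "m \<ge> 1" and \<omega>: "\<And>i. i \<in> {1..m} \<Longrightarrow> \<omega> i > 0"
    and feas: "SOCP_box_feasible m \<omega> p Z"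
  shows "Z $ None $ None > 0"
    and "CR_box_feasible m \<omega> p (\<chi> j. Z $ Some j $ None / Z $ None $ None, 1 / Z $ None $ None)"
proof -
  let ?t = "Z $ None $ None"
  let ?x = "(\<chi> j. Z $ Some j $ None / ?t) :: real ^ 'n"
  have le: "Z $ Some j $ Some j \<le> ?t" and sum0: "0 \<le> Z $ Some j $ Some j + ?t"
    and minor: "(Z $ Some j $ None)\<^sup>2 \<le> Z $ Some j $ Some j * ?t" for j
    using feas by (auto simp: SOCP_box_feasible_def norm_vector_2_le_iff)
  have tr: "1 \<le> \<omega> i * ((\<Sum>j\<in>UNIV. Z $ Some j $ Some j)
      - 2 * (\<Sum>j\<in>UNIV. p i $ j * Z $ Some j $ None) + (norm (p i))\<^sup>2 * ?t)"
    if "i \<in> {1..m}" for i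
  proof -
    have "symmetric_matrix Z" "1 \<le> \<omega> i * trace (A_matrix (p i) ** Z)"
      using feas that by (auto simp: SOCP_box_feasible_def)
    then show ?thesis by (simp add: trace_A_matrix_mult)
  qed
  \<comment> \<open>A zero corner would make the diagonal and the last column vanish, so the
    constraint with index 1, present since \<open>m \<ge> 1\<close>, would read
    \<open>1 \<le> 0\<close>.\<close>
  have "?t \<noteq> 0"
  proof
    assume t: "?t = 0"
    have "Z $ Some j $ Some j = 0" "Z $ Some j $ None = 0" for j
      using le [of j] sum0 [of j] minor [of j] t by auto
    then show False using tr [of 1] m t by simp
  qed
  \<comment> \<open>For a single \<open>j\<close>, the bounds \<open>le\<close> and
    \<open>sum0\<close> add up to \<open>0 \<le> 2 * ?t\<close>; \<open>undefined\<close> serves as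
    an arbitrary index.\<close>
  moreover have "?t \<ge> 0"
    using le [of undefined] sum0 [of undefined] by linarith
  ultimately show pos: "?t > 0" by simp
  have box: "?x $ j \<in> {-1..1}" for j
  proof -
    have "(Z $ Some j $ None)\<^sup>2 \<le> ?t\<^sup>2"
      using order_trans [OF minor [of j] mult_right_mono [OF le [of j]]] pos
      by (simp add: power2_eq_square)
    then have "\<bar>Z $ Some j $ None\<bar> \<le> ?t"
      using pos by (simp add: abs_le_square_iff [symmetric])
    then show ?thesis using pos by (auto simp: abs_le_iff divide_le_eq le_divide_eq)
  qed
  have lin: "1 / ?t \<le> \<omega> i * (real CARD('n) - 2 * (p i \<bullet> ?x) + (norm (p i))\<^sup>2)"
    if i: "i \<in> {1..m}" for i
  proof -
    \<comment> \<open>Bounding every diagonal entry by the corner produces the constant n of the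
      linear program; the positive weight preserves the inequality.\<close>
    have "(\<Sum>j\<in>UNIV. Z $ Some j $ Some j) \<le> real CARD('n) * ?t"
      using sum_bounded_above [of UNIV "\<lambda>j. Z $ Some j $ Some j" ?t] le by simp
    moreover have "(\<Sum>j\<in>UNIV. p i $ j * Z $ Some j $ None) = (p i \<bullet> ?x) * ?t"
      using pos by (simp add: inner_vec_def sum_distrib_right)
    ultimately have "1 \<le> \<omega> i * (real CARD('n) * ?t - 2 * ((p i \<bullet> ?x) * ?t) + (norm (p i))\<^sup>2 * ?t)"
      using tr [OF i] \<omega> [OF i]
      by (smt (verit) mult_left_mono)
    also have "\<dots> = \<omega> i * (real CARD('n) - 2 * (p i \<bullet> ?x) + (norm (p i))\<^sup>2) * ?t"
      by (simp only: algebra_simps)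
    finally show ?thesis using pos by (simp only: divide_le_eq if_True)
  qed
  show "CR_box_feasible m \<omega> p (?x, 1 / ?t)"
    unfolding CR_box_feasible_def using lin box by blast
qed

section \<open>Lifting points of the box to positive semidefinite matrices\<close>

definition box_lift :: "real ^ 'n \<Rightarrow> real ^ ('n option) ^ ('n option)" where
  "box_lift x = (\<chi> r c.
     (case r of
        Some j \<Rightarrow> (case c of Some k \<Rightarrow> if j = k then 1 else x $ j * x $ k | None \<Rightarrow> x $ j)
      | None \<Rightarrow> (case c of Some k \<Rightarrow> x $ k | None \<Rightarrow> 1)))"

text \<open>The lift is the rank-one matrix of \<open>(x, 1)\<close> plus a diagonal matrix with
  entries \<open>1 - (x $ j)^2\<close> and last entry 0. The form is thus a square plus squares
  whose weights are nonnegative on the box.\<close>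

lemma box_lift_quadratic_form:
  fixes x :: "real ^ 'n"
  shows "z \<bullet> (box_lift x *v z) =
    (z $ None + (\<Sum>j\<in>UNIV. x $ j * z $ Some j))\<^sup>2 + (\<Sum>j\<in>UNIV. (1 - (x $ j)\<^sup>2) * (z $ Some j)\<^sup>2)"
proof -
  let ?s = "\<Sum>j\<in>UNIV. x $ j * z $ Some j"
  have row: "(box_lift x *v z) $ Some j
      = x $ j * (z $ None + ?s) + (1 - (x $ j)\<^sup>2) * z $ Some j" for j
  proof -
    have "(\<Sum>k\<in>UNIV. (if j = k then 1 else x $ j * x $ k) * z $ Some k)
      = (\<Sum>k\<in>UNIV. x $ j * (x $ k * z $ Some k) + (if j = k then (1 - (x $ j)\<^sup>2) * z $ Some k else 0))"
      by (intro sum.cong) (auto simp: power2_eq_square algebra_simps)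
    then show ?thesis
      by (simp add: matrix_vector_mult_def box_lift_def sum_option_UNIV sum.distrib
          sum_distrib_left distrib_left)
  qed
  have "(box_lift x *v z) $ None = z $ None + ?s"
    by (simp add: matrix_vector_mult_def box_lift_def sum_option_UNIV)
  then have "z \<bullet> (box_lift x *v z) = z $ None * (z $ None + ?s)
      + (\<Sum>j\<in>UNIV. (x $ j * z $ Some j) * (z $ None + ?s) + (1 - (x $ j)\<^sup>2) * (z $ Some j)\<^sup>2)"
    by (simp add: inner_vec_def sum_option_UNIV row power2_eq_square algebra_simps)
  also have "\<dots> = z $ None * (z $ None + ?s) + ?s * (z $ None + ?s)
      + (\<Sum>j\<in>UNIV. (1 - (x $ j)\<^sup>2) * (z $ Some j)\<^sup>2)"
    by (simp only: sum.distrib sum_distrib_right)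
  finally show ?thesis
    by (simp only: power2_eq_square distrib_right)
qed

lemma CR_box_feasible_imp_SDP_box_feasible:
  fixes p :: "nat \<Rightarrow> real ^ 'n"
  assumes feas: "CR_box_feasible m \<omega> p (x, \<zeta>)" and \<zeta>: "\<zeta> > 0"
  shows "SDP_box_feasible m \<omega> p ((1 / \<zeta>) *\<^sub>R box_lift x)"
proof -
  let ?Z = "(1 / \<zeta>) *\<^sub>R box_lift x"
  have sym: "symmetric_matrix ?Z"
    by (auto simp: symmetric_matrix_def transpose_def box_lift_def vec_eq_iff mult.commute
        split: option.split)
  have box: "(x $ j)\<^sup>2 \<le> 1" for j
    using feas by (auto simp: CR_box_feasible_def abs_square_le_1 abs_le_iff minus_le_iff)
  have "0 \<le> z \<bullet> (?Z *v z)" for z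
    using \<zeta> box
    by (simp add: scaleR_matrix_vector_assoc [symmetric] box_lift_quadratic_form sum_nonneg)
  then have psd: "psd_matrix ?Z"
    using sym by (simp add: psd_matrix_def)
  \<comment> \<open>The unit diagonal contributes n to the trace, where the rank-one matrix alone
    would give only the squared norm of \<open>x\<close>. The constraint becomes that of the linear
    program divided by \<open>\<zeta>\<close>.\<close>
  have "1 \<le> \<omega> i * trace (A_matrix (p i) ** ?Z)" if i: "i \<in> {1..m}" for i
  proof -
    have "trace (A_matrix (p i) ** ?Z)
        = (real CARD('n) - 2 * (p i \<bullet> x) + (norm (p i))\<^sup>2) / \<zeta>"
      unfolding trace_A_matrix_mult [OF sym]
      by (simp add: box_lift_def inner_vec_def
          sum_divide_distrib [symmetric] diff_divide_distrib add_divide_distrib)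
    moreover have "\<zeta> \<le> \<omega> i * (real CARD('n) - 2 * (p i \<bullet> x) + (norm (p i))\<^sup>2)"
      using feas i by (simp add: CR_box_feasible_def)
    ultimately show ?thesis using \<zeta> by simp
  qed
  then show ?thesis
    using sym psd by (simp add: SDP_box_feasible_def box_lift_def)
qed

section \<open>Attainment and positivity of the linear program's maximum\<close>

lemma continuous_on_MIN:
  fixes g :: "'i \<Rightarrow> 'a::topological_space \<Rightarrow> 'b::linorder_topology"
  assumes "finite I" "I \<noteq> {}" "\<And>i. i \<in> I \<Longrightarrow> continuous_on S (g i)"
  shows "continuous_on S (\<lambda>x. MIN i\<in>I. g i x)"
  using assms
  by (induction I rule: finite_ne_induct) (auto intro!: continuous_on_min)

lemma CR_box_attained:
  fixes p :: "nat \<Rightarrow> real ^ 'n"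
  assumes m: "m \<ge> 1" and \<omega>: "\<And>i. i \<in> {1..m} \<Longrightarrow> \<omega> i > 0"
  obtains x \<zeta> where "CR_box_feasible m \<omega> p (x, \<zeta>)" "\<zeta> > 0"
    "\<And>x' \<zeta>'. CR_box_feasible m \<omega> p (x', \<zeta>') \<Longrightarrow> \<zeta>' \<le> \<zeta>"
proof -
  define g where "g i x = \<omega> i * (real CARD('n) - 2 * (p i \<bullet> x) + (norm (p i))\<^sup>2)" for i x
  define f where "f x = (MIN i\<in>{1..m}. g i x)" for x
  let ?B = "{x :: real ^ 'n. \<forall>j. x $ j \<in> {-1..1}}"
  have ne: "{1..m} \<noteq> {}" using m by simp
  \<comment> \<open>Eliminating \<open>\<zeta>\<close> leaves the maximisation of the continuous
    function \<open>f\<close> over the compact box.\<close>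
  have feas_iff: "CR_box_feasible m \<omega> p (x, \<zeta>) \<longleftrightarrow> x \<in> ?B \<and> \<zeta> \<le> f x" for x \<zeta>
    using ne by (auto simp: CR_box_feasible_def f_def g_def)
  have "?B = cbox (\<chi> j. -1) (\<chi> j. 1)"
    by (auto simp: mem_box_cart)
  then have "compact ?B" by (metis compact_cbox)
  moreover have zero: "0 \<in> ?B" by simp
  moreover have "continuous_on ?B f"
    unfolding f_def g_def using ne by (intro continuous_intros continuous_on_MIN) auto
  ultimately obtain x where x: "x \<in> ?B" "\<And>y. y \<in> ?B \<Longrightarrow> f y \<le> f x"
    using continuous_attains_sup [of ?B f] by blast
  \<comment> \<open>At the origin the inner product vanishes, leaving \<open>\<omega> i\<close>
    times n plus a square. The resulting positive maximum can later be inverted.\<close>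
  have "g i 0 > 0" if "i \<in> {1..m}" for i
    using \<omega> [OF that] by (simp add: g_def add_pos_nonneg)
  then have "f 0 > 0" using ne by (simp add: f_def)
  with x(2) [OF zero] have "f x > 0" by linarith
  moreover have "\<zeta>' \<le> f x" if "CR_box_feasible m \<omega> p (x', \<zeta>')" for x' \<zeta>'
    using that x(2) [of x'] unfolding feas_iff by (meson order_trans)
  ultimately show ?thesis
    using that [of x "f x"] x(1) feas_iff by blast
qed

section \<open>Equality of the three values and attainment\<close>

theorem theorem2p1:
  fixes m :: nat and \<omega> :: "nat \<Rightarrow> real" and p :: "nat \<Rightarrow> real ^ 'n"
  assumes "m \<ge> 1"
    and "\<And>i. i \<in> {1..m} \<Longrightarrow> \<omega> i > 0"
  shows "v_CR_box m \<omega> p = v_SDP_box m \<omega> p \<and> v_SDP_box m \<omega> p = v_SOCP_box m \<omega> p \<and>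
    (\<exists>x \<zeta>. CR_box_feasible m \<omega> p (x, \<zeta>) \<and> v_CR_box m \<omega> p = ereal \<zeta>) \<and>
    (\<exists>Z. SDP_box_feasible m \<omega> p Z \<and> 1 / v_SDP_box m \<omega> p = ereal (Z $ None $ None)) \<and>
    (\<exists>Z. SOCP_box_feasible m \<omega> p Z \<and> 1 / v_SOCP_box m \<omega> p = ereal (Z $ None $ None))"
proof -
  obtain x \<zeta> where x: "CR_box_feasible m \<omega> p (x, \<zeta>)" and pos: "\<zeta> > 0"
    and max: "\<And>x' \<zeta>'. CR_box_feasible m \<omega> p (x', \<zeta>') \<Longrightarrow> \<zeta>' \<le> \<zeta>"
    using CR_box_attained [of m \<omega> p] assms by blast
  \<comment> \<open>The lift of one maximiser of the linear program serves as minimiser for both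
    matrix programs.\<close>
  define Z where "Z = (1 / \<zeta>) *\<^sub>R box_lift x"
  have corner: "Z $ None $ None = 1 / \<zeta>"
    by (simp add: Z_def box_lift_def)
  have sdp: "SDP_box_feasible m \<omega> p Z"
    unfolding Z_def using x pos by (rule CR_box_feasible_imp_SDP_box_feasible)
  then have socp: "SOCP_box_feasible m \<omega> p Z"
    by (rule SDP_box_feasible_imp_SOCP_box_feasible)
  \<comment> \<open>The reciprocal of the corner of \<open>Y\<close> is a feasible value of the
    linear program, hence at most \<open>\<zeta>\<close>. The bound also covers the SDP, whose
    feasible set is contained in that of the SOCP.\<close>
  have lower: "1 / \<zeta> \<le> Y $ None $ None" if "SOCP_box_feasible m \<omega> p Y" for Y
    using SOCP_box_feasible_imp_CR_box_feasible [OF assms that] max pos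
    by (metis divide_le_eq mult.commute)
  have "v_CR_box m \<omega> p = ereal \<zeta>"
    unfolding v_CR_box_def
  proof (rule SUP_eqI)
    show "ereal (snd y) \<le> ereal \<zeta>" if "y \<in> {y. CR_box_feasible m \<omega> p y}" for y
      using that max [of "fst y" "snd y"] by simp
    show "ereal \<zeta> \<le> u" if "\<And>y. y \<in> {y. CR_box_feasible m \<omega> p y} \<Longrightarrow> ereal (snd y) \<le> u" for u
      using that [of "(x, \<zeta>)"] x by simp
  qed
  moreover have "v_SDP_box m \<omega> p = ereal \<zeta>"
  proof -
    have "(INF Z\<in>{Z. SDP_box_feasible m \<omega> p Z}. ereal (Z $ None $ None)) = ereal (1 / \<zeta>)"
      using sdp corner by (intro INF_eqI)
        (force intro: lower SDP_box_feasible_imp_SOCP_box_feasible)+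
    then show ?thesis using pos by (simp add: v_SDP_box_def one_ereal_def)
  qed
  moreover have "v_SOCP_box m \<omega> p = ereal \<zeta>"
  proof -
    have "(INF Z\<in>{Z. SOCP_box_feasible m \<omega> p Z}. ereal (Z $ None $ None)) = ereal (1 / \<zeta>)"
      using socp corner by (intro INF_eqI) (force intro: lower)+
    then show ?thesis using pos by (simp add: v_SOCP_box_def one_ereal_def)
  qed
  moreover have "1 / ereal \<zeta> = ereal (Z $ None $ None)"
    using pos by (simp add: corner one_ereal_def)
  ultimately show ?thesis
    using x sdp socp by metis
qed

end
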